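(* Let $\|\cdot\|$ be a norm on $\mathbb R^n$, with open balls $B_r(x)$, let $\Omega$ be an open neighborhood of the origin $0_n$, and let $w$ be a vanishing weight at $0_n$ of domain $\Omega$ which is infinitesimally even at $0_n$. Set $\mu:=w\mathscr L^n$ and consider $(\Omega,\|\cdot\|,\mu)$. Assume that $\mu$ satisfies a comparability condition at $0_n$, that the weights $$\tilde w_r(x):=\frac{w(x)}2\left(1+\frac{\mu(B_r(0_n))}{\mu(B_r(x))}\right)$$ are infinitesimally even at $0_n$, in the sense that $\tilde w_r$ is $\mathscr L^n$-essentially bounded on $B_r(0_n)$ for all small $r$ and $$\mathscr L^n\text{-}\operatorname*{ess\,sup}_{x\in B_r(0_n)}|\tilde w_r(x)-\tilde w_r(-x)|=o\left(r\fint_{B_r(0_n)}\tilde w_r\,d\mathscr L^n\right)\quad\text{as }r\downarrow0,$$ and that there exists a Radon measure $\tilde\nu$ on $B_1(0_n)$ such that $$\tilde\nu_r:=\left(\frac{\tilde w_r(r\,\cdot)\,r^n}{\mu(B_r(0_n))}\right)\mathscr L^n|_{B_1(0_n)}\rightharpoonup\tilde\nu\qquad\text{as }r\downarrow0.$$ Then for any function $u:\Omega\to\mathbb R$ two times differentiable at $0_n$, the pointwise SAMV Laplacian of $u$ at $0_n$ exists and satisfies $$\tilde\Delta^{\|\cdot\|}_\mu u(0_n)=\frac12\mathrm{Tr}\big(M_{\tilde\nu}\nabla^2u(0_n)\big),\qquad M_{\tilde\nu}:=\left(\int_{B_1(0_n)}y_iy_j\,d\tilde\nu(y)\right)_{1\le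 i,j\le n}.$$
   Context: $\mathscr L^n$ is Lebesgue measure; $w\mathscr L^n$ is the measure with density $w$; $\fint_A f\,d\mu:=\frac1{\mu(A)}\int_A f\,d\mu$. Vanishing weight at $0_n$: a Lebesgue integrable function $w$ on a neighborhood $\Omega$ of $0_n$ such that $w(x)>0$ for $\mathscr L^n$-a.e. $x\in\Omega$ and $0_n$ is a Lebesgue point of $w$ with value $0$, i.e. $\lim_{r\downarrow0}\fint_{B_r(0_n)}|w|\,d\mathscr L^n=0$. $w$ infinitesimally even at $0_n$: $w$ is $\mathscr L^n$-essentially bounded in a neighborhood of $0_n$ and $$\mathscr L^n\text{-}\operatorname*{ess\,sup}_{x\in B_r(0_n)}|w(x)-w(-x)|=o\left(r\fint_{B_r(0_n)}w\,d\mathscr L^n\right)\quad\text{as }r\downarrow0.$$ Comparability condition at $0_n$: there exist $r_0,C>0$ such that for any $r\in(0,r_0)$ and $\mu$-a.e. $y\in B_r(0_n)$, $\mu(B_r(0_n))\le C\mu(B_r(y))$. Weak convergence $\rightharpoonup$: the $\tilde\nu_r$ and $\tilde\nu$ are regarded as Radon measures on $\mathbb R^n$ giving no mass to $\mathbb R^n\setminus B_1(0_n)$, and convergence is tested against $C_c(\mathbb R^n)$. "$u$ two times differentiable at $0_n$" means that $u$ is differentiable in a neighborhood of $0_n$ and its gradient is differentiable at $0_n$. The pointwise SAMV Laplacian of $u$ at $0_n$ exists if the finite limit $$\tilde\Delta^{\|\cdot\|}_\mu u(0_n):=\lim_{r\downarrow0}\frac1{2r^2}\fint_{B_r(0_n)}(u(y)-u(0_n))\left(1+\frac{\mu(B_r(0_n))}{\mu(B_r(y))}\right)d\mu(y)$$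 exists. *)

theory Defs
  imports "HOL-Analysis.Analysis" "HOL-Probability.Essential_Supremum"
begin

definition norm_fun :: "(real^'n \<Rightarrow> real) \<Rightarrow> bool" where
  "norm_fun N \<longleftrightarrow>
     (\<forall>x. 0 \<le> N x) \<and> (\<forall>x. N x = 0 \<longleftrightarrow> x = 0) \<and>
     (\<forall>c x. N (c *\<^sub>R x) = \<bar>c\<bar> * N x) \<and> (\<forall>x y. N (x + y) \<le> N x + N y)"

definition nball :: "(real^'n \<Rightarrow> real) \<Rightarrow> real^'n \<Rightarrow> real \<Rightarrow> (real^'n) set" where
  "nball N x r = {y. N (y - x) < r}"

definition avg_integral :: "'a measure \<Rightarrow> 'a set \<Rightarrow> ('a \<Rightarrow> real) \<Rightarrow> real" where
  "avg_integral M A f = (1 / measure M A) * (LINT x:A|M. f x)"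

text \<open>The weighted measure on \<open>\<Omega>\<close>, extended by zero to the whole space: the value on a set \<open>A\<close> is
  that of \<open>A \<inter> \<Omega>\<close>, so that \<open>measure (weighted_measure \<Omega> w) (nball N x r)\<close> is the measure of the
  ball of the metric space \<open>\<Omega>\<close>. Values of \<open>w\<close> outside \<open>\<Omega>\<close> are irrelevant.\<close>

definition weighted_measure :: "(real^'n) set \<Rightarrow> (real^'n \<Rightarrow> real) \<Rightarrow> (real^'n) measure" where
  "weighted_measure \<Omega> w = density lebesgue (\<lambda>x. ennreal (indicator \<Omega> x * w x))"

definition vanishing_weight ::
  "(real^'n \<Rightarrow> real) \<Rightarrow> (real^'n) set \<Rightarrow> (real^'n \<Rightarrow> real) \<Rightarrow> bool" where
  "vanishing_weight N \<Omega> w \<longleftrightarrow>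
     set_integrable lebesgue \<Omega> w \<and>
     (AE x in lebesgue. x \<in> \<Omega> \<longrightarrow> 0 < w x) \<and>
     ((\<lambda>r. avg_integral lebesgue (nball N 0 r) (\<lambda>x. \<bar>w x\<bar>)) \<longlongrightarrow> 0) (at_right 0)"

definition ess_bounded_on :: "(real^'n) set \<Rightarrow> (real^'n \<Rightarrow> real) \<Rightarrow> bool" where
  "ess_bounded_on A f \<longleftrightarrow> (\<exists>K. AE x in lebesgue. x \<in> A \<longrightarrow> \<bar>f x\<bar> \<le> K)"

text \<open>The little-o condition for a family of weights \<open>f r\<close>. It is written with the extended-real
  essential supremum, so that an infinite essential supremum violates it.\<close>

definition ess_sup_odd_part_small ::
  "(real^'n \<Rightarrow> real) \<Rightarrow> (real \<Rightarrow> real^'n \<Rightarrow> real) \<Rightarrow> bool" where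
  "ess_sup_odd_part_small N f \<longleftrightarrow>
     (\<forall>\<epsilon>>0. \<forall>\<^sub>F r in at_right 0.
        esssup (restrict_space lebesgue (nball N 0 r)) (\<lambda>x. ereal \<bar>f r x - f r (- x)\<bar>)
          \<le> ereal (\<epsilon> * (r * avg_integral lebesgue (nball N 0 r) (f r))))"

definition infinitesimally_even ::
  "(real^'n \<Rightarrow> real) \<Rightarrow> (real^'n) set \<Rightarrow> (real^'n \<Rightarrow> real) \<Rightarrow> bool" where
  "infinitesimally_even N \<Omega> w \<longleftrightarrow>
     (\<exists>U. open U \<and> 0 \<in> U \<and> U \<subseteq> \<Omega> \<and> ess_bounded_on U w) \<and>
     ess_sup_odd_part_small N (\<lambda>r. w)"

definition infinitesimally_even_family ::
  "(real^'n \<Rightarrow> real) \<Rightarrow> (real \<Rightarrow> real^'n \<Rightarrow> real) \<Rightarrow> bool" where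
  "infinitesimally_even_family N f \<longleftrightarrow>
     (\<forall>\<^sub>F r in at_right 0. ess_bounded_on (nball N 0 r) (f r)) \<and>
     ess_sup_odd_part_small N f"

definition comparability_at_0 :: "(real^'n \<Rightarrow> real) \<Rightarrow> (real^'n) measure \<Rightarrow> bool" where
  "comparability_at_0 N \<mu> \<longleftrightarrow>
     (\<exists>r0>0. \<exists>C>0. \<forall>r. 0 < r \<and> r < r0 \<longrightarrow>
        (AE y in \<mu>. y \<in> nball N 0 r \<longrightarrow>
           measure \<mu> (nball N 0 r) \<le> C * measure \<mu> (nball N y r)))"

definition sym_weight ::
  "(real^'n \<Rightarrow> real) \<Rightarrow> (real^'n) set \<Rightarrow> (real^'n \<Rightarrow> real) \<Rightarrow> real \<Rightarrow> real^'n \<Rightarrow> real" where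
  "sym_weight N \<Omega> w r x =
     w x / 2 * (1 + measure (weighted_measure \<Omega> w) (nball N 0 r)
                    / measure (weighted_measure \<Omega> w) (nball N x r))"

definition rescaled_measure ::
  "(real^'n \<Rightarrow> real) \<Rightarrow> (real^'n) set \<Rightarrow> (real^'n \<Rightarrow> real) \<Rightarrow> real \<Rightarrow> (real^'n) measure" where
  "rescaled_measure N \<Omega> w r =
     density lebesgue (\<lambda>y. ennreal (indicator (nball N 0 1) y *
       (sym_weight N \<Omega> w r (r *\<^sub>R y) * r ^ CARD('n)
          / measure (weighted_measure \<Omega> w) (nball N 0 r))))"

text \<open>On \<open>\<real>\<^sup>n\<close> a Borel measure that is finite on compact sets is automatically regular.\<close>

definition radon_measure :: "(real^'n) measure \<Rightarrow> bool" where
  "radon_measure \<nu> \<longleftrightarrow> sets \<nu> = sets borel \<and> (\<forall>K. compact K \<longrightarrow> emeasure \<nu> K < \<infinity>)"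

definition weakly_converges ::
  "('i \<Rightarrow> (real^'n) measure) \<Rightarrow> (real^'n) measure \<Rightarrow> 'i filter \<Rightarrow> bool" where
  "weakly_converges \<nu>s \<nu> F \<longleftrightarrow>
     (\<forall>\<phi> :: real^'n \<Rightarrow> real. continuous_on UNIV \<phi> \<and> compact (closure {x. \<phi> x \<noteq> 0}) \<longrightarrow>
        ((\<lambda>r. LINT x|\<nu>s r. \<phi> x) \<longlongrightarrow> (LINT x|\<nu>. \<phi> x)) F)"

definition gradient :: "(real^'n \<Rightarrow> real) \<Rightarrow> real^'n \<Rightarrow> real^'n" where
  "gradient u x = (\<chi> i. frechet_derivative u (at x) (axis i 1))"

definition two_times_differentiable_at :: "(real^'n \<Rightarrow> real) \<Rightarrow> real^'n \<Rightarrow> bool" where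
  "two_times_differentiable_at u x \<longleftrightarrow>
     (\<forall>\<^sub>F y in nhds x. u differentiable (at y)) \<and> gradient u differentiable (at x)"

definition hessian :: "(real^'n \<Rightarrow> real) \<Rightarrow> real^'n \<Rightarrow> real^'n^'n" where
  "hessian u x = matrix (frechet_derivative (gradient u) (at x))"

text \<open>\<open>has_samv_laplacian N \<mu> u x L\<close>: the limit defining the pointwise SAMV Laplacian at \<open>x\<close> exists
  and equals \<open>L\<close>. The Bochner integral of a non-integrable function is \<open>0\<close> by convention, so
  integrability for small radii is made part of the existence claim.\<close>

definition has_samv_laplacian ::
  "(real^'n \<Rightarrow> real) \<Rightarrow> (real^'n) measure \<Rightarrow> (real^'n \<Rightarrow> real) \<Rightarrow> real^'n \<Rightarrow> real \<Rightarrow> bool" where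
  "has_samv_laplacian N \<mu> u x L \<longleftrightarrow>
     (let f = (\<lambda>r y. (u y - u x) * (1 + measure \<mu> (nball N x r) / measure \<mu> (nball N y r)))
      in (\<forall>\<^sub>F r in at_right 0. set_integrable \<mu> (nball N x r) (f r)) \<and>
         ((\<lambda>r. 1 / (2 * r\<^sup>2) * avg_integral \<mu> (nball N x r) (f r)) \<longlongrightarrow> L) (at_right 0))"

definition moment_matrix :: "(real^'n \<Rightarrow> real) \<Rightarrow> (real^'n) measure \<Rightarrow> real^'n^'n" where
  "moment_matrix N \<nu> = (\<chi> i j. LINT y:nball N 0 1|\<nu>. y $ i * y $ j)"

end

theory Submission
  imports Defs
begin

text \<open>
  Up to the factor \<open>1 / r\<^sup>2\<close>, the average defining the SAMV Laplacian is the integral of \<open>u - u 0\<close>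
  against the symmetrised weight on the ball of radius \<open>r\<close>, divided by the measure of that ball.
  Expand \<open>u\<close> to second order at \<open>0\<close>. On the symmetric ball the linear term only sees the odd part of
  the weight, which is \<open>o(r)\<close> relative to its mean, so this term contributes \<open>o(r\<^sup>2)\<close>. Rescaling to the
  unit ball turns the quadratic term into a second moment of the rescaled measures, which converges to
  the one of \<open>\<nu>\<close>, and the Taylor remainder is \<open>o(r\<^sup>2)\<close> because the rescaled masses converge.
\<close>

section \<open>Comparison of \<open>N\<close> with the Euclidean norm\<close>

text \<open>Expanding a vector in the standard basis bounds \<open>N\<close> by a multiple of the
  Euclidean norm; the reverse triangle inequality then makes \<open>N\<close> Lipschitz.\<close>

lemma norm_fun_continuous_on:
  fixes N :: "real^'n \<Rightarrow> real"
  assumes "norm_fun N"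
  shows "continuous_on S N"
proof -
  have tri: "N (x + y) \<le> N x + N y" and hom: "N (c *\<^sub>R x) = \<bar>c\<bar> * N x" and nn: "0 \<le> N x" for x y c
    using assms by (auto simp: norm_fun_def)
  have neg: "N (- x) = N x" for x
    using hom[of "-1" x] by simp
  let ?B = "\<Sum>i\<in>Basis. N i"
  have B: "N x \<le> ?B * norm x" for x
  proof -
    have "N (\<Sum>i\<in>F. (x \<bullet> i) *\<^sub>R i) \<le> (\<Sum>i\<in>F. N i * norm x)" if "finite F" "F \<subseteq> Basis" for F
      using that
    proof (induction F rule: finite_induct)
      case empty
      then show ?case using hom[of 0 0] by simp
    next
      case (insert i F)
      have "N ((x \<bullet> i) *\<^sub>R i) \<le> N i * norm x"
        using Basis_le_norm[of i x] insert.prems nn[of i] by (simp add: hom mult.commute mult_left_mono)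
      then show ?case
        using insert tri[of "(x \<bullet> i) *\<^sub>R i" "\<Sum>i\<in>F. (x \<bullet> i) *\<^sub>R i"] by auto
    qed
    from this[of Basis] show ?thesis
      by (simp add: euclidean_representation sum_distrib_right)
  qed
  have "\<bar>N x - N y\<bar> \<le> N (x - y)" for x y
    using tri[of "x - y" y] tri[of "y - x" x] neg[of "x - y"] by simp
  then have "dist (N x) (N y) \<le> ?B * dist x y" for x y
    using B[of "x - y"] by (auto simp: dist_norm intro: order_trans)
  then have "?B-lipschitz_on S N"
    by (intro lipschitz_onI sum_nonneg nn) auto
  then show ?thesis
    by (rule lipschitz_on_continuous_on)
qed

text \<open>\<open>N\<close> is continuous and positive on the compact Euclidean unit sphere, so it
  has a positive minimum there; homogeneity carries this bound to all vectors.\<close>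

lemma norm_fun_dominates_norm:
  fixes N :: "real^'n \<Rightarrow> real"
  assumes "norm_fun N"
  obtains K where "K > 0" "\<And>x. norm x \<le> K * N x"
proof -
  have hom: "N (c *\<^sub>R x) = \<bar>c\<bar> * N x" and nn: "0 \<le> N x" and zero: "N x = 0 \<longleftrightarrow> x = 0" for x c
    using assms by (auto simp: norm_fun_def)
  have "sphere (0::real^'n) 1 \<noteq> {}"
    by simp
  then obtain z where z: "z \<in> sphere 0 1" "\<And>x. x \<in> sphere 0 1 \<Longrightarrow> N z \<le> N x"
    using continuous_attains_inf[OF compact_sphere _ norm_fun_continuous_on[OF assms]] by metis
  have pos: "N z > 0"
    using z(1) zero[of z] nn[of z] by (auto simp: less_le)
  have "norm x \<le> (1 / N z) * N x" for x
  proof (cases "x = 0")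
    case False
    then have "N z \<le> N ((1 / norm x) *\<^sub>R x)"
      by (intro z(2)) simp
    also have "\<dots> = N x / norm x"
      using hom[of "1 / norm x" x] by simp
    finally show ?thesis
      using False pos by (simp add: field_simps)
  qed (simp add: nn)
  with pos show ?thesis
    by (intro that[of "1 / N z"]) auto
qed

lemma open_nball:
  assumes "norm_fun N"
  shows "open (nball N x r)"
  unfolding nball_def
  by (intro open_Collect_less continuous_intros continuous_on_compose2[OF norm_fun_continuous_on[OF assms, of UNIV]]) auto

section \<open>Lebesgue measure under dilations\<close>

lemma lebesgue_eq_density_distr_scaleR:
  assumes c: "c \<noteq> 0"
  shows "(lebesgue :: 'a::euclidean_space measure) =
    density (distr lebesgue lebesgue ((*\<^sub>R) c)) (\<lambda>_. ennreal (\<bar>c\<bar> ^ DIM('a)))"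
proof -
  have "(\<Sum>j\<in>Basis. (c * (x \<bullet> j)) *\<^sub>R j) = c *\<^sub>R x" for x :: 'a
    unfolding scaleR_scaleR[symmetric] scaleR_sum_right[symmetric] euclidean_representation ..
  then show ?thesis
    using lebesgue_affine_euclidean[of "\<lambda>_. c" "0::'a"] c by (simp add: ennreal_power)
qed

text \<open>Used with \<open>c\<close> equal to -1 for the reflection of a ball and with the radius
  for the passage to the unit ball. The first identity asks only for measurability: without
  integrability both integrals are 0.\<close>

lemma integral_lebesgue_scaleR:
  fixes f :: "'a::euclidean_space \<Rightarrow> real"
  assumes c: "c \<noteq> 0" and f: "f \<in> borel_measurable lebesgue"
  shows "(LINT x|lebesgue. f x) = \<bar>c\<bar> ^ DIM('a) * (LINT x|lebesgue. f (c *\<^sub>R x))"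
    and "integrable lebesgue f \<longleftrightarrow> integrable lebesgue (\<lambda>x. f (c *\<^sub>R x))"
proof -
  note leb = lebesgue_eq_density_distr_scaleR[OF c, where 'a='a]
  have fd: "f \<in> borel_measurable (distr lebesgue lebesgue ((*\<^sub>R) c))"
    using f by simp
  have "(LINT x|lebesgue. f x) = (LINT x|density (distr lebesgue lebesgue ((*\<^sub>R) c)) (\<lambda>_. ennreal (\<bar>c\<bar> ^ DIM('a))). f x)"
    by (simp flip: leb)
  also have "\<dots> = \<bar>c\<bar> ^ DIM('a) * (LINT x|lebesgue. f (c *\<^sub>R x))"
    by (subst integral_density[OF fd]) (simp_all add: integral_distr[OF lebesgue_measurable_scaling f])
  finally show "(LINT x|lebesgue. f x) = \<bar>c\<bar> ^ DIM('a) * (LINT x|lebesgue. f (c *\<^sub>R x))" .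
  have "integrable lebesgue f \<longleftrightarrow> integrable (density (distr lebesgue lebesgue ((*\<^sub>R) c)) (\<lambda>_. ennreal (\<bar>c\<bar> ^ DIM('a)))) f"
    by (simp flip: leb)
  also have "\<dots> \<longleftrightarrow> integrable lebesgue (\<lambda>x. f (c *\<^sub>R x))"
    using c by (subst integrable_density[OF fd]) (simp_all add: integrable_distr_eq[OF lebesgue_measurable_scaling f])
  finally show "integrable lebesgue f \<longleftrightarrow> integrable lebesgue (\<lambda>x. f (c *\<^sub>R x))" .
qed

section \<open>Measurability of the measure of a moving ball\<close>

text \<open>The balls of radius \<open>r\<close> are the vertical sections of one open subset of the
  product space, and section measures depend measurably on the base point.\<close>

lemma borel_measurable_measure_nball:
  fixes N :: "real^'n \<Rightarrow> real"
  assumes N: "norm_fun N" and \<mu>: "finite_measure \<mu>" and sets: "sets \<mu> = sets lebesgue"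
  shows "(\<lambda>x. measure \<mu> (nball N x r)) \<in> borel_measurable borel"
proof -
  interpret finite_measure \<mu> by fact
  let ?Q = "{p :: (real^'n) \<times> (real^'n). N (snd p - fst p) < r}"
  have "open ?Q"
    by (intro open_Collect_less continuous_intros continuous_on_compose2[OF norm_fun_continuous_on[OF N, of UNIV]]) auto
  then have Q: "?Q \<in> sets (borel \<Otimes>\<^sub>M borel)"
    unfolding borel_prod by simp
  \<comment> \<open>\<open>\<mu>\<close> lives on the completed sigma-algebra, so the open set is
    pulled back along the identity from the Borel product to the product with
    \<open>\<mu>\<close>.\<close>
  have "id \<in> borel \<Otimes>\<^sub>M \<mu> \<rightarrow>\<^sub>M borel \<Otimes>\<^sub>M borel"
    unfolding id_def
  proof (rule measurable_pair)
    show "fst \<circ> (\<lambda>x. x) \<in> borel \<Otimes>\<^sub>M \<mu> \<rightarrow>\<^sub>M borel"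
      by (simp add: o_def)
    have "(\<lambda>x. x) \<in> \<mu> \<rightarrow>\<^sub>M (borel :: (real^'n) measure)"
      using measurable_completion[OF measurable_ident_sets[of lborel borel]] sets
      by (simp cong: measurable_cong_sets)
    then show "snd \<circ> (\<lambda>x. x) \<in> borel \<Otimes>\<^sub>M \<mu> \<rightarrow>\<^sub>M borel"
      using measurable_compose[OF measurable_snd] by (force simp: o_def)
  qed
  from measurable_sets[OF this Q] have "?Q \<in> sets (borel \<Otimes>\<^sub>M \<mu>)"
    using sets_eq_imp_space_eq[OF sets] by (simp add: space_pair_measure)
  from measurable_emeasure_Pair[OF this]
  have "(\<lambda>x. enn2real (emeasure \<mu> (Pair x -` ?Q))) \<in> borel_measurable borel"
    by measurable
  moreover have "Pair x -` ?Q = nball N x r" for x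
    by (auto simp: nball_def)
  ultimately show ?thesis
    by (simp add: measure_def)
qed

section \<open>Taylor expansion to second order\<close>

lemma gradient_works:
  fixes u :: "real^'n \<Rightarrow> real"
  assumes "u differentiable (at x)"
  shows "(u has_derivative (\<lambda>h. gradient u x \<bullet> h)) (at x)"
proof -
  let ?D = "frechet_derivative u (at x)"
  have D: "(u has_derivative ?D) (at x)"
    using assms by (simp add: frechet_derivative_works)
  then have lin: "linear ?D"
    by (rule has_derivative_linear)
  have "?D h = gradient u x \<bullet> h" for h
  proof -
    have "?D h = ?D (\<Sum>i\<in>UNIV. (h $ i) *\<^sub>R axis i 1)"
      using basis_expansion[of h] by (simp add: scalar_mult_eq_scaleR)
    also have "\<dots> = (\<Sum>i\<in>UNIV. h $ i * ?D (axis i 1))"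
      by (simp add: linear_sum[OF lin] linear_scale[OF lin])
    finally show ?thesis
      by (simp add: gradient_def inner_vec_def mult.commute)
  qed
  then have "?D = (\<lambda>h. gradient u x \<bullet> h)"
    by (rule ext)
  with D show ?thesis by simp
qed

lemma hessian_works:
  fixes u :: "real^'n \<Rightarrow> real"
  assumes "gradient u differentiable (at x)"
  shows "(gradient u has_derivative (\<lambda>h. hessian u x *v h)) (at x)"
proof -
  let ?D = "frechet_derivative (gradient u) (at x)"
  have D: "(gradient u has_derivative ?D) (at x)"
    using assms by (simp add: frechet_derivative_works)
  then have "linear ?D"
    by (rule has_derivative_linear)
  then have "?D h = hessian u x *v h" for h
    unfolding hessian_def using matrix_works[of ?D h] by (simp add: linear_def scalar_mult_eq_scaleR[abs_def])
  then have "?D = (\<lambda>h. hessian u x *v h)"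
    by (rule ext)
  with D show ?thesis by simp
qed

text \<open>The gradient is differentiable at 0 only, so the argument runs along the segment from 0
  to \<open>y\<close>: the mean value inequality bounds the remainder by the first-order error of
  the gradient.\<close>

lemma second_order_taylor:
  fixes u :: "real^'n \<Rightarrow> real"
  assumes "two_times_differentiable_at u 0" and "\<epsilon> > 0"
  shows "\<forall>\<^sub>F y in nhds 0.
    \<bar>u y - u 0 - gradient u 0 \<bullet> y - (y \<bullet> (hessian u 0 *v y)) / 2\<bar> \<le> \<epsilon> * (norm y)\<^sup>2"
proof -
  let ?g = "gradient u" and ?H = "hessian u 0"
  have "(?g has_derivative (\<lambda>h. ?H *v h)) (at 0)"
    using assms(1) by (intro hessian_works) (simp add: two_times_differentiable_at_def)
  then obtain d1 where d1: "d1 > 0"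
    "\<And>y. norm y < d1 \<Longrightarrow> norm (?g y - ?g 0 - ?H *v y) \<le> \<epsilon> * norm y"
    using \<open>\<epsilon> > 0\<close> unfolding has_derivative_at_alt by (metis diff_zero)
  obtain d2 where d2: "d2 > 0" "\<And>y. norm y < d2 \<Longrightarrow> u differentiable (at y)"
    using assms(1) unfolding two_times_differentiable_at_def eventually_nhds_metric
    by (auto simp: dist_norm)
  have "\<bar>u y - u 0 - ?g 0 \<bullet> y - (y \<bullet> (?H *v y)) / 2\<bar> \<le> \<epsilon> * (norm y)\<^sup>2"
    if y: "norm y < min d1 d2" for y
  proof -
    \<comment> \<open>The derivative of \<open>h\<close> at \<open>t\<close> is the first-order
      error of the gradient at \<open>t *\<^sub>R y\<close>, paired with \<open>y\<close>; the
      increment \<open>h 1 - h 0\<close> is the Taylor remainder.\<close>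
    define h where "h t = u (t *\<^sub>R y) - t * (?g 0 \<bullet> y) - t\<^sup>2 * (y \<bullet> (?H *v y)) / 2" for t
    have ny: "norm (t *\<^sub>R y) < min d1 d2" "norm (t *\<^sub>R y) \<le> norm y" if "t \<in> {0..1}" for t
      using that y mult_left_le_one_le[of "norm y" "\<bar>t\<bar>"] by auto
    have "(h has_real_derivative (?g (t *\<^sub>R y) - ?g 0 - ?H *v (t *\<^sub>R y)) \<bullet> y) (at t within {0..1})"
      if t: "t \<in> {0..1}" for t
    proof -
      have "(u has_derivative (\<lambda>h. ?g (t *\<^sub>R y) \<bullet> h)) (at (t *\<^sub>R y))"
        using ny(1)[OF t] by (intro gradient_works d2(2)) simp
      then have "((\<lambda>t. u (t *\<^sub>R y)) has_derivative (\<lambda>s. ?g (t *\<^sub>R y) \<bullet> (s *\<^sub>R y))) (at t within {0..1})"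
        by (rule has_derivative_compose[rotated]) (auto intro!: derivative_eq_intros)
      then have "((\<lambda>t. u (t *\<^sub>R y)) has_real_derivative ?g (t *\<^sub>R y) \<bullet> y) (at t within {0..1})"
        unfolding has_field_derivative_def
        by (rule has_derivative_eq_rhs) (simp add: fun_eq_iff)
      then show ?thesis
        unfolding h_def
        by (auto intro!: derivative_eq_intros simp: inner_diff_left inner_commute[of y] matrix_vector_mult_scaleR)
    qed
    moreover have "norm ((?g (t *\<^sub>R y) - ?g 0 - ?H *v (t *\<^sub>R y)) \<bullet> y) \<le> \<epsilon> * (norm y)\<^sup>2"
      if t: "t \<in> {0..1}" for t
    proof -
      have "norm (?g (t *\<^sub>R y) - ?g 0 - ?H *v (t *\<^sub>R y)) \<le> \<epsilon> * norm (t *\<^sub>R y)"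
        using ny(1)[OF t] by (intro d1(2)) simp
      also have "\<dots> \<le> \<epsilon> * norm y"
        using ny(2)[OF t] \<open>\<epsilon> > 0\<close> by (intro mult_left_mono) auto
      finally have "norm (?g (t *\<^sub>R y) - ?g 0 - ?H *v (t *\<^sub>R y)) * norm y \<le> \<epsilon> * norm y * norm y"
        by (rule mult_right_mono) simp
      then show ?thesis
        using Cauchy_Schwarz_ineq2[of "?g (t *\<^sub>R y) - ?g 0 - ?H *v (t *\<^sub>R y)" y]
        by (simp add: power2_eq_square mult.assoc)
    qed
    ultimately have "norm (h 1 - h 0) \<le> \<epsilon> * (norm y)\<^sup>2 * norm (1 - 0 :: real)"
      by (intro field_differentiable_bound[of "{0..1}"]) auto
    then show ?thesis
      by (simp add: h_def algebra_simps)
  qed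
  then show ?thesis
    unfolding eventually_nhds_metric
    using d1(1) d2(1) by (intro exI[of _ "min d1 d2"]) (auto simp: dist_norm)
qed

section \<open>Integrals of bounded multiples and the odd part of a weight\<close>

lemma borel_measurable_lebesgueI:
  "f \<in> borel_measurable borel \<Longrightarrow> f \<in> borel_measurable lebesgue"
  by (simp add: measurable_completion)

lemma AE_lebesgue_scaleR:
  fixes c :: real
  assumes "c \<noteq> 0" and Q: "AE x in lebesgue. Q (x :: 'a::euclidean_space)"
  shows "AE x in lebesgue. Q (c *\<^sub>R x)"
proof -
  have "AE x in density (distr lebesgue lebesgue ((*\<^sub>R) c)) (\<lambda>_. ennreal (\<bar>c\<bar> ^ DIM('a))). Q x"
    by (rule subst[OF lebesgue_eq_density_distr_scaleR[OF assms(1)], where P="\<lambda>M. AE x in M. Q x"]) (rule Q)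
  then have "AE x in distr lebesgue lebesgue ((*\<^sub>R) c). Q x"
    using assms(1) by (simp add: AE_density)
  then show ?thesis
    by (rule AE_distrD[OF lebesgue_measurable_scaling])
qed

text \<open>Since \<open>P\<close> vanishes off \<open>B\<close>, measurability and the bound of
  \<open>h\<close> are asked on \<open>B\<close> alone; this fits factors such as
  \<open>u y - u 0\<close>, which are controlled only near 0.\<close>

lemma integrable_mult_bounded_on:
  fixes P h :: "'a \<Rightarrow> real"
  assumes P: "integrable M P" and supp: "\<And>x. x \<notin> B \<Longrightarrow> P x = 0"
    and h: "(\<lambda>x. indicator B x * h x) \<in> borel_measurable M" and bd: "\<And>x. x \<in> B \<Longrightarrow> \<bar>h x\<bar> \<le> C"
  shows "integrable M (\<lambda>x. P x * h x)"
proof (rule Bochner_Integration.integrable_bound)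
  show "integrable M (\<lambda>x. C * P x)"
    using P by simp
  have "(\<lambda>x. P x * (indicator B x * h x)) \<in> borel_measurable M"
    by (rule borel_measurable_times[OF borel_measurable_integrable[OF P] h])
  moreover have "P x * (indicator B x * h x) = P x * h x" for x
    using supp[of x] by (auto simp: indicator_def)
  ultimately show "(\<lambda>x. P x * h x) \<in> borel_measurable M"
    by simp
  have "\<bar>P x * h x\<bar> \<le> \<bar>C * P x\<bar>" for x
  proof (cases "x \<in> B")
    case True
    with bd[OF True] show ?thesis
      by (simp add: abs_mult mult.commute[of "\<bar>P x\<bar>"] mult_right_mono)
  qed (simp add: supp)
  then show "AE x in M. norm (P x * h x) \<le> norm (C * P x)"
    by simp
qed

text \<open>Reflection turns the integral into minus the integral of
  \<open>P (- x) * (a \<bullet> x)\<close>. Averaging both forms leaves the difference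
  \<open>P x - P (- x)\<close> and gives the factor 1/2; the integrand is then bounded on a set of
  finite measure.\<close>

lemma odd_moment_bound:
  fixes P :: "'a::euclidean_space \<Rightarrow> real"
  assumes P: "integrable lebesgue P" and supp: "\<And>x. x \<notin> B \<Longrightarrow> P x = 0"
    and B: "B \<in> lmeasurable" and sym: "\<And>x. - x \<in> B \<longleftrightarrow> x \<in> B"
    and R: "\<And>x. x \<in> B \<Longrightarrow> norm x \<le> R"
    and odd: "AE x in lebesgue. x \<in> B \<longrightarrow> \<bar>P x - P (- x)\<bar> \<le> \<delta>"
  shows "\<bar>LINT x|lebesgue. P x * (a \<bullet> x)\<bar> \<le> norm a * R * \<delta> * measure lebesgue B / 2"
proof -
  have axB: "\<bar>a \<bullet> x\<bar> \<le> norm a * R" if "x \<in> B" for x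
    using Cauchy_Schwarz_ineq2[of a x] mult_left_mono[OF R[OF that], of "norm a"] by simp
  have meas: "(\<lambda>x. indicator B x * (a \<bullet> x)) \<in> borel_measurable lebesgue"
    using B by (intro borel_measurable_times borel_measurable_indicator measurable_completion) (auto simp: fmeasurable_def)
  have int: "integrable lebesgue (\<lambda>x. P x * (a \<bullet> x))"
    by (rule integrable_mult_bounded_on[OF P supp meas axB])
  have int': "integrable lebesgue (\<lambda>x. P (- x) * (a \<bullet> x))"
    using int integral_lebesgue_scaleR(2)[of "-1" "\<lambda>x. P x * (a \<bullet> x)"] by simp
  have "(LINT x|lebesgue. P x * (a \<bullet> x)) = - (LINT x|lebesgue. P (- x) * (a \<bullet> x))"
    using integral_lebesgue_scaleR(1)[of "-1" "\<lambda>x. P x * (a \<bullet> x)"] int by simp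
  then have "2 * (LINT x|lebesgue. P x * (a \<bullet> x)) = (LINT x|lebesgue. (P x - P (- x)) * (a \<bullet> x))"
    using int int' by (simp add: left_diff_distrib)
  also have "\<bar>\<dots>\<bar> \<le> (LINT x|lebesgue. norm ((P x - P (- x)) * (a \<bullet> x)))"
    using integral_norm_bound[of lebesgue "\<lambda>x. (P x - P (- x)) * (a \<bullet> x)"] by simp
  also have "\<dots> \<le> (LINT x|lebesgue. norm a * R * \<delta> * indicator B x)"
  proof (rule integral_mono_AE)
    show "integrable lebesgue (\<lambda>x. norm ((P x - P (- x)) * (a \<bullet> x)))"
      using int int' by (simp add: left_diff_distrib)
    show "integrable lebesgue (\<lambda>x. norm a * R * \<delta> * indicator B x)"
      using B by (intro integrable_mult_right integrable_real_indicator) (auto simp: fmeasurable_def)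
    show "AE x in lebesgue. norm ((P x - P (- x)) * (a \<bullet> x)) \<le> norm a * R * \<delta> * indicator B x"
      using odd
    proof eventually_elim
      case (elim x)
      show ?case
      proof (cases "x \<in> B")
        case True
        then have "\<bar>P x - P (- x)\<bar> * \<bar>a \<bullet> x\<bar> \<le> \<delta> * (norm a * R)"
          using elim axB[OF True] by (intro mult_mono) auto
        then show ?thesis
          using True by (simp add: abs_mult mult_ac)
      qed (use supp sym in simp)
    qed
  qed
  also have "\<dots> = norm a * R * \<delta> * measure lebesgue B"
    using B by (simp add: fmeasurable_def)
  finally show ?thesis
    by simp
qed

text \<open>Converts the extended-real form of the evenness hypothesis into the almost-everywhere
  form that \<open>odd_moment_bound\<close> takes.\<close>

lemma esssup_restrict_space_le_AE:
  fixes f :: "'a \<Rightarrow> ereal"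
  assumes "esssup (restrict_space M A) f \<le> c" and "A \<in> sets M"
  shows "AE x in M. x \<in> A \<longrightarrow> f x \<le> c"
proof -
  have "AE x in restrict_space M A. f x \<le> c"
    using esssup_AE[of f "restrict_space M A"] by eventually_elim (use assms(1) in auto)
  then show ?thesis
    using assms(2) by (subst (asm) AE_restrict_space_iff) auto
qed

section \<open>The symmetrised weight on small balls\<close>

locale weight_near_0 =
  fixes N :: "real^'n \<Rightarrow> real" and \<Omega> :: "(real^'n) set" and w :: "real^'n \<Rightarrow> real"
  assumes N: "norm_fun N" and \<Omega>: "open \<Omega>" "0 \<in> \<Omega>"
    and w_int: "set_integrable lebesgue \<Omega> w"
    and w_pos: "AE x in lebesgue. x \<in> \<Omega> \<longrightarrow> 0 < w x"
begin

abbreviation "B \<equiv> nball N 0"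
abbreviation "m r \<equiv> measure (weighted_measure \<Omega> w) (B r)"

text \<open>The weight is cut off at the ball, so that integrals over \<open>B r\<close> become
  integrals over the whole space, to which reflection and dilation apply directly.\<close>

definition ball_weight :: "real \<Rightarrow> real^'n \<Rightarrow> real" where
  "ball_weight r x = indicator (B r) x * sym_weight N \<Omega> w r x"

lemma mem_B: "x \<in> B r \<longleftrightarrow> N x < r"
  by (simp add: nball_def)

lemma B_uminus: "- x \<in> B r \<longleftrightarrow> x \<in> B r"
  using N by (simp add: mem_B norm_fun_def) (metis abs_1 abs_minus_cancel lambda_one scaleR_minus1_left)

lemma scaleR_mem_B:
  assumes "r > 0"
  shows "r *\<^sub>R x \<in> B r \<longleftrightarrow> x \<in> B 1"
  using N assms by (simp add: mem_B norm_fun_def)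

lemma B_borel: "B r \<in> sets borel"
  by (simp add: open_nball[OF N])

text \<open>One constant \<open>K\<close> serves all radii. The last clause lets properties valid in
  a Euclidean neighbourhood of 0 pass to small balls of \<open>N\<close>.\<close>

lemma B_norm_bound:
  obtains K where "K > 0" "\<And>r x. x \<in> B r \<Longrightarrow> norm x \<le> K * r"
    "\<And>d. d > 0 \<Longrightarrow> \<forall>\<^sub>F r in at_right 0. B r \<subseteq> ball 0 d"
proof -
  obtain K where K: "K > 0" "\<And>x. norm x \<le> K * N x"
    using norm_fun_dominates_norm[OF N] by blast
  have bd: "norm x < K * r" if "x \<in> B r" for r x
    using that K(2)[of x] mult_strict_left_mono[OF _ K(1), of "N x" r] by (simp add: mem_B)
  have "\<forall>\<^sub>F r in at_right 0. B r \<subseteq> ball 0 d" if "d > 0" for d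
  proof -
    have "0 < d / K"
      using that K(1) by simp
    from eventually_at_right_real[OF this] show ?thesis
    proof eventually_elim
      case (elim r)
      then have "K * r < d"
        using K(1) by (simp add: field_simps)
      then show ?case
        using bd[of _ r] by force
    qed
  qed
  with bd K(1) show ?thesis
    by (intro that[of K]) (auto intro: less_imp_le)
qed

lemma B_lmeasurable: "B r \<in> lmeasurable"
proof -
  obtain K where "\<And>x. x \<in> B r \<Longrightarrow> norm x \<le> K * r"
    using B_norm_bound by metis
  then have "bounded (B r)"
    by (auto simp: bounded_iff)
  then show ?thesis
    by (rule lmeasurable_open) (rule open_nball[OF N])
qed

lemma density_measurable: "(\<lambda>x. indicator \<Omega> x * w x) \<in> borel_measurable lebesgue"
  using w_int by (auto simp: set_integrable_def)

lemma density_nonneg: "AE x in lebesgue. 0 \<le> indicator \<Omega> x * w x"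
  using w_pos by eventually_elim (auto simp: indicator_def)

lemma sets_weighted_measure: "sets (weighted_measure \<Omega> w) = sets lebesgue"
  by (simp add: weighted_measure_def)

lemma finite_weighted_measure: "finite_measure (weighted_measure \<Omega> w)"
proof
  have "emeasure (weighted_measure \<Omega> w) (space (weighted_measure \<Omega> w))
    = (\<integral>\<^sup>+x. ennreal (indicator \<Omega> x * w x) \<partial>lebesgue)"
    using density_measurable by (simp add: weighted_measure_def emeasure_density)
  also have "\<dots> \<le> (\<integral>\<^sup>+x. ennreal (norm (indicator \<Omega> x * w x)) \<partial>lebesgue)"
    by (intro nn_integral_mono ennreal_leI) simp
  also have "\<dots> < \<infinity>"
    using w_int by (simp add: set_integrable_def integrable_iff_bounded)
  finally show "emeasure (weighted_measure \<Omega> w) (space (weighted_measure \<Omega> w)) \<noteq> \<infinity>"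
    by simp
qed

lemma measurable_ball_ratio:
  "(\<lambda>x. 1 + m r / measure (weighted_measure \<Omega> w) (nball N x r)) \<in> borel_measurable borel"
  using borel_measurable_measure_nball[OF N finite_weighted_measure sets_weighted_measure]
  by measurable

text \<open>\<open>sym_weight\<close> contains \<open>w\<close> itself, whereas measurability and
  sign are known for \<open>w\<close> cut off at \<open>\<Omega>\<close>; inside
  \<open>\<Omega>\<close> the cut-off can be inserted freely.\<close>

lemma ball_weight_eq:
  assumes "B r \<subseteq> \<Omega>"
  shows "ball_weight r x = indicator (B r) x * (indicator \<Omega> x * w x) *
    (1 + m r / measure (weighted_measure \<Omega> w) (nball N x r)) / 2"
  using assms by (auto simp: ball_weight_def sym_weight_def indicator_def)

lemma ball_weight_measurable:
  assumes "B r \<subseteq> \<Omega>"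
  shows "ball_weight r \<in> borel_measurable lebesgue"
proof -
  have "(\<lambda>x. indicator (B r) x * (indicator \<Omega> x * w x) *
    (1 + m r / measure (weighted_measure \<Omega> w) (nball N x r)) / 2) \<in> borel_measurable lebesgue"
    by (rule borel_measurable_divide[OF borel_measurable_times[OF borel_measurable_times[OF _ density_measurable]
          borel_measurable_lebesgueI[OF measurable_ball_ratio]]])
       (simp_all add: B_borel borel_measurable_lebesgueI borel_measurable_indicator)
  then show ?thesis
    by (simp add: ball_weight_eq[OF assms, abs_def])
qed

lemma ball_weight_nonneg:
  assumes "B r \<subseteq> \<Omega>"
  shows "AE x in lebesgue. 0 \<le> ball_weight r x"
  using density_nonneg
  by eventually_elim (simp add: ball_weight_eq[OF assms] zero_le_mult_iff)

text \<open>An essentially bounded measurable function supported in a set of finite Lebesgue measure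
  is integrable.\<close>

lemma ball_weight_integrable:
  assumes "B r \<subseteq> \<Omega>" and bd: "ess_bounded_on (B r) (sym_weight N \<Omega> w r)"
  shows "integrable lebesgue (ball_weight r)"
proof -
  obtain C where "AE x in lebesgue. x \<in> B r \<longrightarrow> \<bar>sym_weight N \<Omega> w r x\<bar> \<le> C"
    using bd by (auto simp: ess_bounded_on_def)
  then show ?thesis
    using B_lmeasurable[of r]
    by (intro integrableI_bounded_set[where A="B r" and B=C] ball_weight_measurable assms)
       (auto simp: fmeasurable_def ball_weight_def)
qed

section \<open>Moments of the rescaled measures\<close>

text \<open>The factor \<open>r ^ CARD('n)\<close> in the density is the Jacobian of the dilation by
  \<open>r\<close>. Were \<open>m r\<close> zero, division by zero would make both sides 0.\<close>

lemma integral_rescaled_measure: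
  assumes r: "r > 0" and sub: "B r \<subseteq> \<Omega>" and g: "g \<in> borel_measurable borel"
  shows "(LINT y|rescaled_measure N \<Omega> w r. g y) = (1 / m r) * (LINT y|lebesgue. ball_weight r y * g ((1 / r) *\<^sub>R y))"
proof -
  let ?k = "r ^ CARD('n) / m r"
  have "r \<noteq> 0"
    using r by simp
  have gl: "g \<in> borel_measurable lebesgue"
    using g by (simp add: measurable_completion)
  have Pr: "(\<lambda>y. ball_weight r (r *\<^sub>R y)) \<in> borel_measurable lebesgue"
    by (rule measurable_compose[OF lebesgue_measurable_scaling ball_weight_measurable[OF sub]])
  have gr: "(\<lambda>y. g ((1 / r) *\<^sub>R y)) \<in> borel_measurable lebesgue"
    by (rule measurable_compose[OF lebesgue_measurable_scaling gl])
  have "rescaled_measure N \<Omega> w r = density lebesgue (\<lambda>y. ennreal (?k * ball_weight r (r *\<^sub>R y)))"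
    unfolding rescaled_measure_def
    by (rule arg_cong[where f="density lebesgue"])
       (auto simp: fun_eq_iff ball_weight_def indicator_def scaleR_mem_B[OF r] mult_ac)
  then have "(LINT y|rescaled_measure N \<Omega> w r. g y) = (LINT y|density lebesgue (\<lambda>y. ennreal (?k * ball_weight r (r *\<^sub>R y))). g y)"
    by simp
  also have "\<dots> = (LINT y|lebesgue. ?k * ball_weight r (r *\<^sub>R y) * g y)"
  proof (subst integral_density)
    \<comment> \<open>The weight is nonnegative only almost everywhere; dilations preserve null
      sets, so this survives the rescaling.\<close>
    show "AE y in lebesgue. 0 \<le> ?k * ball_weight r (r *\<^sub>R y)"
      using AE_lebesgue_scaleR[OF \<open>r \<noteq> 0\<close> ball_weight_nonneg[OF sub]] by eventually_elim (use r in auto)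
  qed (use gl Pr in auto)
  also have "\<dots> = (1 / m r) * (r ^ CARD('n) * (LINT y|lebesgue. ball_weight r (r *\<^sub>R y) * g ((1 / r) *\<^sub>R (r *\<^sub>R y))))"
    using r by (simp add: mult.assoc)
  also have "r ^ CARD('n) * (LINT y|lebesgue. ball_weight r (r *\<^sub>R y) * g ((1 / r) *\<^sub>R (r *\<^sub>R y)))
    = (LINT y|lebesgue. ball_weight r y * g ((1 / r) *\<^sub>R y))"
    using integral_lebesgue_scaleR(1)[of r "\<lambda>y. ball_weight r y * g ((1 / r) *\<^sub>R y)"] r
      ball_weight_measurable[OF sub] gr by simp
  finally show ?thesis .
qed

text \<open>Extends weak convergence to continuous \<open>g\<close> without compact support. The
  constant 1 yields convergence of the masses, a quadratic form that of the second moments.\<close>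

lemma rescaled_moments_tendsto:
  assumes sub: "\<forall>\<^sub>F r in at_right 0. B r \<subseteq> \<Omega>"
    and \<nu>: "radon_measure \<nu>" "emeasure \<nu> (UNIV - B 1) = 0"
    and conv: "weakly_converges (rescaled_measure N \<Omega> w) \<nu> (at_right 0)"
    and g: "continuous_on UNIV g"
  shows "((\<lambda>r. (1 / m r) * (LINT y|lebesgue. ball_weight r y * g ((1 / r) *\<^sub>R y)))
    \<longlongrightarrow> (LINT y:B 1|\<nu>. g y)) (at_right 0)"
proof -
  \<comment> \<open>The cut-off is \<open>1\<close> on the closed unit ball; as \<open>\<nu>\<close> does not charge the complement of the
    open one, no mass is lost to the unit sphere.\<close>
  define \<phi> where "\<phi> y = max 0 (min 1 (2 - N y)) * g y" for y
  have \<phi>1: "\<phi> y = g y" if "y \<in> B 1" for y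
    using that by (simp add: \<phi>_def mem_B)
  have cont: "continuous_on UNIV \<phi>"
    unfolding \<phi>_def by (intro continuous_intros norm_fun_continuous_on N g)
  then have meas: "\<phi> \<in> borel_measurable borel" and measg: "g \<in> borel_measurable borel"
    using g by (auto intro: borel_measurable_continuous_onI)
  obtain K where K: "K > 0" "\<And>x. norm x \<le> K * N x"
    using norm_fun_dominates_norm[OF N] by blast
  have "norm y \<le> K * 2" if "\<phi> y \<noteq> 0" for y
  proof -
    have "N y \<le> 2"
      using that by (auto simp: \<phi>_def max_def min_def split: if_splits)
    then show ?thesis
      using K(2)[of y] mult_left_mono[of "N y" 2 K] K(1) by linarith
  qed
  then have "bounded {y. \<phi> y \<noteq> 0}"
    by (auto simp: bounded_iff)
  then have "compact (closure {y. \<phi> y \<noteq> 0})"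
    by simp
  with conv cont have lim: "((\<lambda>r. LINT y|rescaled_measure N \<Omega> w r. \<phi> y) \<longlongrightarrow> (LINT y|\<nu>. \<phi> y)) (at_right 0)"
    by (simp add: weakly_converges_def)
  have sets: "sets \<nu> = sets borel"
    using \<nu> by (simp add: radon_measure_def)
  have "AE y in \<nu>. y \<in> B 1"
    using \<nu>(2) sets B_borel[of 1] sets_eq_imp_space_eq[OF sets]
    by (intro AE_I[of _ _ "UNIV - B 1"]) auto
  then have "(LINT y|\<nu>. \<phi> y) = (LINT y|\<nu>. indicator (B 1) y *\<^sub>R g y)"
    using meas measg B_borel[of 1] sets
    by (intro integral_cong_AE) (auto simp: \<phi>1 cong: measurable_cong_sets)
  then have "(LINT y|\<nu>. \<phi> y) = (LINT y:B 1|\<nu>. g y)"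
    by (simp add: set_lebesgue_integral_def)
  moreover have "\<forall>\<^sub>F r in at_right 0. (LINT y|rescaled_measure N \<Omega> w r. \<phi> y)
    = (1 / m r) * (LINT y|lebesgue. ball_weight r y * g ((1 / r) *\<^sub>R y))"
    using sub eventually_at_right_less[of 0]
  proof eventually_elim
    case (elim r)
    have eq: "ball_weight r y * \<phi> ((1 / r) *\<^sub>R y) = ball_weight r y * g ((1 / r) *\<^sub>R y)" for y
      using \<phi>1[of "(1 / r) *\<^sub>R y"] scaleR_mem_B[OF elim(2), of "(1 / r) *\<^sub>R y"] elim(2)
      by (cases "y \<in> B r") (simp_all add: ball_weight_def)
    then show ?case
      by (simp only: integral_rescaled_measure[OF elim(2,1) meas] eq)
  qed
  ultimately show ?thesis
    using Lim_transform_eventually[OF lim] by (simp only:)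
qed

section \<open>The SAMV average against the quadratic moment\<close>

text \<open>\<open>F\<close> is the SAMV integrand with \<open>v\<close> in place of the increment
  of \<open>u\<close>. The factor 2 compensates the 1/2 inside \<open>sym_weight\<close>, and later
  cancels the 2 in the normalisation of the Laplacian.\<close>

lemma samv_average_eq:
  fixes v :: "real^'n \<Rightarrow> real"
  assumes sub: "B r \<subseteq> \<Omega>" and v: "continuous_on (B r) v" and bd: "\<And>y. y \<in> B r \<Longrightarrow> \<bar>v y\<bar> \<le> C"
    and P: "integrable lebesgue (ball_weight r)"
  defines "F \<equiv> \<lambda>y. v y * (1 + m r / measure (weighted_measure \<Omega> w) (nball N y r))"
  shows "integrable lebesgue (\<lambda>y. ball_weight r y * v y)"
    and "set_integrable (weighted_measure \<Omega> w) (B r) F"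
    and "(LINT y:B r|weighted_measure \<Omega> w. F y) = 2 * (LINT y|lebesgue. ball_weight r y * v y)"
proof -
  have vm: "(\<lambda>y. indicator (B r) y * v y) \<in> borel_measurable lebesgue"
    using borel_measurable_lebesgueI[OF borel_measurable_continuous_on_indicator[OF B_borel v]]
    by simp
  have "(\<lambda>y. (indicator (B r) y * v y) * (1 + m r / measure (weighted_measure \<Omega> w) (nball N y r)))
      \<in> borel_measurable lebesgue"
    using vm borel_measurable_lebesgueI[OF measurable_ball_ratio]
    by (rule borel_measurable_times)
  then have Fm: "(\<lambda>y. indicator (B r) y *\<^sub>R F y) \<in> borel_measurable lebesgue"
    by (simp add: F_def mult.assoc)
  show int: "integrable lebesgue (\<lambda>y. ball_weight r y * v y)"
    by (rule integrable_mult_bounded_on[OF P _ vm bd]) (simp add: ball_weight_def)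
  have eq: "(indicator \<Omega> y * w y) *\<^sub>R (indicator (B r) y *\<^sub>R F y) = 2 * (ball_weight r y * v y)" for y
    by (simp add: ball_weight_eq[OF sub] F_def)
  show "set_integrable (weighted_measure \<Omega> w) (B r) F"
    unfolding set_integrable_def weighted_measure_def
    using int by (simp only: integrable_density[OF Fm density_measurable density_nonneg] eq) simp
  show "(LINT y:B r|weighted_measure \<Omega> w. F y) = 2 * (LINT y|lebesgue. ball_weight r y * v y)"
    unfolding set_lebesgue_integral_def weighted_measure_def
    by (simp only: integral_density[OF Fm density_measurable density_nonneg] eq) simp
qed

text \<open>\<open>B r\<close> lies in a compact Euclidean ball, on which \<open>g\<close> is
  bounded.\<close>

lemma ball_weight_mult_integrable:
  assumes sub: "B r \<subseteq> \<Omega>" and P: "integrable lebesgue (ball_weight r)" and g: "continuous_on UNIV g"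
  shows "integrable lebesgue (\<lambda>y. ball_weight r y * (g y :: real))"
proof -
  obtain K where K: "\<And>x. x \<in> B r \<Longrightarrow> norm x \<le> K * r"
    using B_norm_bound by metis
  have "compact (g ` cball 0 (K * r))"
    by (rule compact_continuous_image[OF continuous_on_subset[OF g]]) auto
  then obtain C where C: "\<And>y. y \<in> cball 0 (K * r) \<Longrightarrow> \<bar>g y\<bar> \<le> C"
    by (metis bounded_iff compact_imp_bounded imageI real_norm_def)
  show ?thesis
    by (rule samv_average_eq(1)[OF sub continuous_on_subset[OF g] _ P]) (use C K in auto)
qed

text \<open>Splits \<open>v\<close> into remainder, linear and quadratic part. The quadratic part is
  matched exactly; the remainder contributes the term with \<open>K\<^sup>2\<close>, and the linear
  part, through the odd part of the weight, the term with \<open>norm a * K / 2\<close>.\<close>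

lemma samv_average_estimate:
  fixes a :: "real^'n" and H :: "real^'n^'n"
  assumes r: "r > 0" and sub: "B r \<subseteq> \<Omega>" and P: "integrable lebesgue (ball_weight r)"
    and K: "\<And>y. y \<in> B r \<Longrightarrow> norm y \<le> K * r" and "0 \<le> K" and "0 \<le> \<epsilon>"
    and v: "continuous_on (B r) v"
    and taylor: "\<And>y. y \<in> B r \<Longrightarrow> \<bar>v y - a \<bullet> y - (y \<bullet> (H *v y)) / 2\<bar> \<le> \<epsilon> * (norm y)\<^sup>2"
    and odd: "AE y in lebesgue. y \<in> B r \<longrightarrow> \<bar>sym_weight N \<Omega> w r y - sym_weight N \<Omega> w r (- y)\<bar>
      \<le> \<epsilon> * (r * avg_integral lebesgue (B r) (sym_weight N \<Omega> w r))"
  shows "\<bar>(LINT y|lebesgue. ball_weight r y * v y) / r\<^sup>2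
      - (LINT y|lebesgue. ball_weight r y * (((1 / r) *\<^sub>R y) \<bullet> (H *v ((1 / r) *\<^sub>R y)))) / 2\<bar>
    \<le> \<epsilon> * (K\<^sup>2 + norm a * K / 2) * (LINT y|lebesgue. ball_weight r y)"
proof -
  let ?P = "ball_weight r"
  define q where "q y = y \<bullet> (H *v y)" for y
  define \<rho> where "\<rho> y = v y - a \<bullet> y - q y / 2" for y
  have cq: "continuous_on S q" for S
    unfolding q_def by (intro continuous_intros)
  have ca: "continuous_on S (\<lambda>y. a \<bullet> y)" for S
    by (intro continuous_intros)
  have \<rho>_bound: "\<bar>\<rho> y\<bar> \<le> \<epsilon> * (K * r)\<^sup>2" if "y \<in> B r" for y
    using taylor[OF that] mult_left_mono[OF power_mono[OF K[OF that], of 2] \<open>0 \<le> \<epsilon>\<close>]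
    by (simp add: \<rho>_def q_def)
  have c\<rho>: "continuous_on (B r) \<rho>"
    unfolding \<rho>_def by (intro continuous_intros v cq) simp
  have int\<rho>: "integrable lebesgue (\<lambda>y. ?P y * \<rho> y)"
    by (rule samv_average_eq(1)[OF sub c\<rho> \<rho>_bound P])
  have inta: "integrable lebesgue (\<lambda>y. ?P y * (a \<bullet> y))"
    by (rule ball_weight_mult_integrable[OF sub P ca])
  have intq: "integrable lebesgue (\<lambda>y. ?P y * q y)"
    by (rule ball_weight_mult_integrable[OF sub P cq])
  have split: "(LINT y|lebesgue. ?P y * v y) =
      (LINT y|lebesgue. ?P y * \<rho> y) + (LINT y|lebesgue. ?P y * (a \<bullet> y)) + (LINT y|lebesgue. ?P y * q y) / 2"
  proof -
    have "?P y * v y = ?P y * \<rho> y + ?P y * (a \<bullet> y) + (?P y * q y) / 2" for y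
      by (simp add: \<rho>_def algebra_simps)
    then show ?thesis
      using int\<rho> inta intq by simp
  qed
  \<comment> \<open>The quadratic form is homogeneous of degree two, so the dilation comes out as
    \<open>1 / r\<^sup>2\<close>.\<close>
  have scaled: "(LINT y|lebesgue. ?P y * (((1 / r) *\<^sub>R y) \<bullet> (H *v ((1 / r) *\<^sub>R y)))) = (LINT y|lebesgue. ?P y * q y) / r\<^sup>2"
    by (simp add: q_def matrix_vector_mult_scaleR power2_eq_square flip: integral_divide_zero)
  have "\<bar>LINT y|lebesgue. ?P y * \<rho> y\<bar> \<le> (LINT y|lebesgue. norm (?P y * \<rho> y))"
    using integral_norm_bound[of lebesgue "\<lambda>y. ?P y * \<rho> y"] by simp
  also have "\<dots> \<le> (LINT y|lebesgue. (\<epsilon> * (K * r)\<^sup>2) * ?P y)"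
  proof (rule integral_mono_AE)
    show "AE y in lebesgue. norm (?P y * \<rho> y) \<le> (\<epsilon> * (K * r)\<^sup>2) * ?P y"
      using ball_weight_nonneg[OF sub]
    proof eventually_elim
      case (elim y)
      show ?case
      proof (cases "y \<in> B r")
        case True
        then show ?thesis
          using elim mult_right_mono[OF \<rho>_bound[OF True] elim] by (simp add: abs_mult mult.commute)
      qed (simp add: ball_weight_def)
    qed
  qed (use int\<rho> P in auto)
  finally have rem: "\<bar>LINT y|lebesgue. ?P y * \<rho> y\<bar> \<le> \<epsilon> * K\<^sup>2 * (LINT y|lebesgue. ?P y) * r\<^sup>2"
    by (simp add: power_mult_distrib mult_ac)
  \<comment> \<open>The linear part is of order \<open>r\<^sup>2\<close>: one \<open>r\<close> comes
    from the evenness bound \<open>\<epsilon> * (r * A)\<close>, the other from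
    \<open>norm y \<le> K * r\<close>.\<close>
  define A where "A = avg_integral lebesgue (B r) (sym_weight N \<Omega> w r)"
  have "avg_integral lebesgue (B r) (sym_weight N \<Omega> w r) = (1 / measure lebesgue (B r)) * (LINT y|lebesgue. ?P y)"
    by (simp add: avg_integral_def set_lebesgue_integral_def ball_weight_def[abs_def])
  moreover have "0 \<le> (LINT y|lebesgue. ?P y)"
    by (rule integral_nonneg_AE[OF ball_weight_nonneg[OF sub]])
  \<comment> \<open>An equality when the ball has positive Lebesgue measure; otherwise the left side
    is 0 and nonnegativity of the integral suffices.\<close>
  ultimately have avg: "A * measure lebesgue (B r) \<le> (LINT y|lebesgue. ?P y)"
    by (cases "measure lebesgue (B r) = 0") (simp_all add: A_def)
  have "AE y in lebesgue. y \<in> B r \<longrightarrow> \<bar>?P y - ?P (- y)\<bar> \<le> \<epsilon> * (r * A)"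
    using odd by eventually_elim (auto simp: ball_weight_def B_uminus A_def)
  then have "\<bar>LINT y|lebesgue. ?P y * (a \<bullet> y)\<bar> \<le> norm a * (K * r) * (\<epsilon> * (r * A)) * measure lebesgue (B r) / 2"
    by (intro odd_moment_bound P B_lmeasurable B_uminus K) (auto simp: ball_weight_def)
  also have "\<dots> = (norm a * K * \<epsilon> / 2 * r\<^sup>2) * (A * measure lebesgue (B r))"
    by (simp add: power2_eq_square mult_ac)
  also have "\<dots> \<le> (norm a * K * \<epsilon> / 2 * r\<^sup>2) * (LINT y|lebesgue. ?P y)"
    using avg \<open>0 \<le> K\<close> \<open>0 \<le> \<epsilon>\<close> by (intro mult_left_mono) auto
  finally have "\<bar>(LINT y|lebesgue. ?P y * \<rho> y) + (LINT y|lebesgue. ?P y * (a \<bullet> y))\<bar>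
      \<le> \<epsilon> * (K\<^sup>2 + norm a * K / 2) * (LINT y|lebesgue. ?P y) * r\<^sup>2"
    using rem by (simp add: algebra_simps)
  then have "\<bar>((LINT y|lebesgue. ?P y * \<rho> y) + (LINT y|lebesgue. ?P y * (a \<bullet> y))) / r\<^sup>2\<bar>
      \<le> \<epsilon> * (K\<^sup>2 + norm a * K / 2) * (LINT y|lebesgue. ?P y)"
    using r by (simp add: divide_le_eq)
  then show ?thesis
    unfolding scaled split by (simp add: add_divide_distrib)
qed

section \<open>Second moments and the trace\<close>

text \<open>The unit ball of \<open>N\<close> lies in a compact Euclidean ball, so
  \<open>\<nu>\<close> gives it finite mass and every second moment is integrable; the form can then
  be integrated entry by entry.\<close>

lemma integral_quadratic_form_eq_trace:
  assumes "radon_measure \<nu>"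
  shows "(LINT y:B 1|\<nu>. y \<bullet> (H *v y)) = trace (moment_matrix N \<nu> ** H)"
proof -
  have sets: "sets \<nu> = sets borel"
    using assms by (simp add: radon_measure_def)
  obtain K where K: "K > 0" "\<And>y. y \<in> B 1 \<Longrightarrow> norm y \<le> K"
    using B_norm_bound by (metis mult.right_neutral)
  have "emeasure \<nu> (B 1) \<le> emeasure \<nu> (cball 0 K)"
    using K by (intro emeasure_mono) (auto simp: sets)
  also have "\<dots> < \<infinity>"
    using assms by (simp add: radon_measure_def)
  finally have fin: "emeasure \<nu> (B 1) < \<infinity>" .
  have int: "integrable \<nu> (\<lambda>y. indicator (B 1) y * (y $ i * y $ j))" for i j
  proof (rule integrableI_bounded_set[where A="B 1" and B="K * K"])
    show "B 1 \<in> sets \<nu>"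
      using B_borel sets by simp
    have "(\<lambda>y. indicator (B 1) y * (y $ i * y $ j)) \<in> borel_measurable borel"
      using B_borel[of 1] by (intro borel_measurable_times borel_measurable_indicator borel_measurable_continuous_onI continuous_intros) auto
    then show "(\<lambda>y. indicator (B 1) y * (y $ i * y $ j)) \<in> borel_measurable \<nu>"
      using sets by (simp cong: measurable_cong_sets)
    have "\<bar>y $ i * y $ j\<bar> \<le> K * K" if "y \<in> B 1" for y
      unfolding abs_mult
      using K(1) order_trans[OF component_le_norm_cart K(2)[OF that]] by (intro mult_mono) auto
    then show "AE y in \<nu>. y \<in> B 1 \<longrightarrow> norm (indicator (B 1) y * (y $ i * y $ j)) \<le> K * K"
      by simp
  qed (use fin in auto)
  \<comment> \<open>The coordinates are ordered \<open>y $ j * y $ i\<close> so that entry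
    \<open>j\<close>, \<open>i\<close> of the moment matrix meets \<open>H $ i $ j\<close>, as in
    the trace of the product.\<close>
  have "indicator (B 1) y *\<^sub>R (y \<bullet> (H *v y)) = (\<Sum>i\<in>UNIV. \<Sum>j\<in>UNIV. (indicator (B 1) y * (y $ j * y $ i)) * H $ i $ j)" for y
    by (simp add: inner_vec_def matrix_vector_mult_def sum_distrib_left mult_ac)
  then have "(LINT y:B 1|\<nu>. y \<bullet> (H *v y)) = (\<Sum>i\<in>UNIV. \<Sum>j\<in>UNIV. (LINT y|\<nu>. indicator (B 1) y * (y $ j * y $ i)) * H $ i $ j)"
    using int by (simp add: set_lebesgue_integral_def)
  also have "\<dots> = (\<Sum>i\<in>UNIV. \<Sum>j\<in>UNIV. moment_matrix N \<nu> $ j $ i * H $ i $ j)"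
    by (simp add: moment_matrix_def set_lebesgue_integral_def)
  also have "\<dots> = trace (moment_matrix N \<nu> ** H)"
    unfolding trace_def matrix_matrix_mult_def by (subst sum.swap) simp
  finally show ?thesis .
qed

end

section \<open>Passage to the limit\<close>

theorem proposition5p10:
  fixes N :: "real^'n \<Rightarrow> real" and \<Omega> :: "(real^'n) set" and w u :: "real^'n \<Rightarrow> real"
    and \<mu> \<nu> :: "(real^'n) measure"
  assumes "norm_fun N"
    and "open \<Omega>" and "0 \<in> \<Omega>"
    and "vanishing_weight N \<Omega> w"
    and "infinitesimally_even N \<Omega> w"
    and \<mu>_def: "\<mu> = weighted_measure \<Omega> w"
    and "comparability_at_0 N \<mu>"
    and "infinitesimally_even_family N (sym_weight N \<Omega> w)"
    and "radon_measure \<nu>"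
    and "emeasure \<nu> (UNIV - nball N 0 1) = 0"
    and "weakly_converges (rescaled_measure N \<Omega> w) \<nu> (at_right 0)"
    and "two_times_differentiable_at u 0"
  shows "has_samv_laplacian N \<mu> u 0 (1 / 2 * trace (moment_matrix N \<nu> ** hessian u 0))"
proof -
  interpret weight_near_0 N \<Omega> w
    using assms(1-4) by unfold_locales (auto simp: vanishing_weight_def)
  let ?a = "gradient u 0" and ?H = "hessian u 0"
  \<comment> \<open>For small \<open>r\<close>, \<open>S r\<close> is the mass of the rescaled
    measure, \<open>Q r\<close> its integral of the Hessian form, and
    \<open>D r / (r\<^sup>2 * m r)\<close> the quantity whose limit is the Laplacian.\<close>
  define D where "D r = (LINT y|lebesgue. ball_weight r y * (u y - u 0))" for r
  define I where "I r = (LINT y|lebesgue. ball_weight r y * (((1 / r) *\<^sub>R y) \<bullet> (?H *v ((1 / r) *\<^sub>R y))))" for r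
  define Q where "Q r = (1 / m r) * I r" for r
  define S where "S r = (1 / m r) * (LINT y|lebesgue. ball_weight r y)" for r
  obtain K where K: "K > 0" "\<And>r y. y \<in> B r \<Longrightarrow> norm y \<le> K * r"
    and small: "\<And>d. d > 0 \<Longrightarrow> \<forall>\<^sub>F r in at_right 0. B r \<subseteq> ball 0 d"
    using B_norm_bound by blast
  have near: "\<forall>\<^sub>F r in at_right 0. \<forall>y\<in>B r. R y" if R: "\<forall>\<^sub>F y in nhds 0. R y" for R
  proof -
    obtain d where "d > 0" "\<And>y. y \<in> ball 0 d \<Longrightarrow> R y"
      using R by (auto simp: eventually_nhds_metric dist_commute)
    with small[OF this(1)] show ?thesis
      by (auto elim!: eventually_mono)
  qed
  have sub: "\<forall>\<^sub>F r in at_right 0. B r \<subseteq> \<Omega>"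
    using near[OF eventually_nhds_in_open[OF \<Omega>]] by (simp add: subset_eq)
  have P: "\<forall>\<^sub>F r in at_right 0. integrable lebesgue (ball_weight r)"
    using sub conjunct1[OF assms(8)[unfolded infinitesimally_even_family_def]]
    by eventually_elim (rule ball_weight_integrable)
  have diff: "\<forall>\<^sub>F y in nhds 0. u differentiable (at y)"
    using assms(12) by (simp add: two_times_differentiable_at_def)
  have cont: "\<forall>\<^sub>F r in at_right 0. continuous_on (B r) (\<lambda>y. u y - u 0)"
    using near[OF diff]
    by eventually_elim
       (auto intro!: continuous_intros continuous_at_imp_continuous_on differentiable_imp_continuous_within)
  \<comment> \<open>Continuity bounds the increment of \<open>u\<close> on small balls; the bound 1
    is an arbitrary choice for the constant \<open>C\<close> of
    \<open>samv_average_eq\<close>.\<close>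
  have "isCont u 0"
    using eventually_nhds_x_imp_x[OF diff] by (rule differentiable_imp_continuous_within)
  then have "\<forall>\<^sub>F y in nhds 0. dist (u y) (u 0) < 1"
    by (intro tendstoD) (auto simp: isCont_def tendsto_at_iff_tendsto_nhds)
  then have bdd: "\<forall>\<^sub>F r in at_right 0. \<forall>y\<in>B r. \<bar>u y - u 0\<bar> \<le> 1"
    by (intro near) (auto simp: dist_real_def elim: eventually_mono)
  have S: "(S \<longlongrightarrow> (LINT y:B 1|\<nu>. (1::real))) (at_right 0)"
    using rescaled_moments_tendsto[OF sub assms(9-11), of "\<lambda>_. 1"] by (simp add: S_def[abs_def])
  have Q: "(Q \<longlongrightarrow> trace (moment_matrix N \<nu> ** ?H)) (at_right 0)"
  proof -
    have "continuous_on UNIV (\<lambda>y. y \<bullet> (?H *v y))"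
      by (intro continuous_intros)
    from rescaled_moments_tendsto[OF sub assms(9-11) this] show ?thesis
      by (simp only: Q_def[abs_def] I_def integral_quadratic_form_eq_trace[OF assms(9)])
  qed
  \<comment> \<open>The same \<open>\<epsilon>\<close> controls the Taylor remainder and the odd
    part of the weight.\<close>
  have estimate: "\<forall>\<^sub>F r in at_right 0. \<bar>D r / (r\<^sup>2 * m r) - Q r / 2\<bar> \<le> \<epsilon> * (K\<^sup>2 + norm ?a * K / 2) * S r"
    if \<epsilon>: "\<epsilon> > 0" for \<epsilon>
  proof -
    have odd: "\<forall>\<^sub>F r in at_right 0. AE y in lebesgue. y \<in> B r \<longrightarrow>
        \<bar>sym_weight N \<Omega> w r y - sym_weight N \<Omega> w r (- y)\<bar>
          \<le> \<epsilon> * (r * avg_integral lebesgue (B r) (sym_weight N \<Omega> w r))"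
    proof -
      have "\<forall>\<^sub>F r in at_right 0. esssup (restrict_space lebesgue (B r))
          (\<lambda>y. ereal \<bar>sym_weight N \<Omega> w r y - sym_weight N \<Omega> w r (- y)\<bar>)
          \<le> ereal (\<epsilon> * (r * avg_integral lebesgue (B r) (sym_weight N \<Omega> w r)))"
        using assms(8) \<epsilon> by (simp add: infinitesimally_even_family_def ess_sup_odd_part_small_def)
      then show ?thesis
      proof eventually_elim
        case (elim r)
        from esssup_restrict_space_le_AE[OF this] show ?case
          using B_lmeasurable[of r] by (simp add: fmeasurable_def)
      qed
    qed
    show ?thesis
      using sub P cont odd near[OF second_order_taylor[OF assms(12) \<epsilon>]] eventually_at_right_less[of 0]
    proof eventually_elim
      case (elim r)
      have "\<bar>D r / r\<^sup>2 - I r / 2\<bar>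
          \<le> \<epsilon> * (K\<^sup>2 + norm ?a * K / 2) * (LINT y|lebesgue. ball_weight r y)"
        unfolding D_def I_def using elim K \<epsilon> by (intro samv_average_estimate) auto
      \<comment> \<open>\<open>1 / m r\<close> is nonnegative, also with the value 0 that division
        by zero would give, so the estimate can be normalised.\<close>
      then have "(1 / m r) * \<bar>D r / r\<^sup>2 - I r / 2\<bar>
          \<le> (1 / m r) * (\<epsilon> * (K\<^sup>2 + norm ?a * K / 2) * (LINT y|lebesgue. ball_weight r y))"
        by (rule mult_left_mono) simp
      moreover have "D r / (r\<^sup>2 * m r) - Q r / 2 = (1 / m r) * (D r / r\<^sup>2 - I r / 2)"
        by (simp add: Q_def right_diff_distrib mult_ac)
      ultimately show ?case
        by (simp add: abs_mult S_def mult_ac)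
    qed
  qed
  have "((\<lambda>r. D r / (r\<^sup>2 * m r) - Q r / 2) \<longlongrightarrow> 0) (at_right 0)"
  proof (rule tendstoI)
    fix e :: real assume "e > 0"
    \<comment> \<open>\<open>s\<close> is positive and exceeds the limit of \<open>S\<close>, hence
      bounds \<open>S r\<close> for small \<open>r\<close>. With \<open>c\<close> the constant of
      the estimate, taking \<open>e / (2 * c * s)\<close> for \<open>\<epsilon>\<close> leaves an
      error of at most \<open>e / 2\<close>.\<close>
    define s where "s = \<bar>LINT y:B 1|\<nu>. (1::real)\<bar> + 1"
    define c where "c = K\<^sup>2 + norm ?a * K / 2"
    have "s > 0" "c > 0"
      using K(1) by (auto simp: s_def c_def intro!: add_pos_nonneg)
    have "0 < e / (2 * c * s)"
      using \<open>e > 0\<close> \<open>c > 0\<close> \<open>s > 0\<close> by simp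
    moreover have "\<forall>\<^sub>F r in at_right 0. S r < s"
      using S by (rule order_tendstoD) (auto simp: s_def)
    ultimately have "\<forall>\<^sub>F r in at_right 0. S r < s
        \<and> \<bar>D r / (r\<^sup>2 * m r) - Q r / 2\<bar> \<le> e / (2 * c * s) * c * S r"
      using estimate[of "e / (2 * c * s)"] by (simp add: c_def eventually_conj)
    then have "\<forall>\<^sub>F r in at_right 0. \<bar>D r / (r\<^sup>2 * m r) - Q r / 2\<bar> < e"
    proof eventually_elim
      case (elim r)
      then have "\<bar>D r / (r\<^sup>2 * m r) - Q r / 2\<bar> \<le> e / (2 * c * s) * c * S r"
        by simp
      also have "\<dots> \<le> e / (2 * c * s) * c * s"
        using \<open>e > 0\<close> \<open>c > 0\<close> \<open>s > 0\<close> elim by (intro mult_left_mono) auto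
      also have "\<dots> < e"
        using \<open>e > 0\<close> \<open>c > 0\<close> \<open>s > 0\<close> by simp
      finally show ?case .
    qed
    then show "\<forall>\<^sub>F r in at_right 0. dist (D r / (r\<^sup>2 * m r) - Q r / 2) 0 < e"
      by simp
  qed
  from tendsto_add[OF this tendsto_mult_left[OF Q, of "1 / 2"]]
  have lim: "((\<lambda>r. D r / (r\<^sup>2 * m r)) \<longlongrightarrow> 1 / 2 * trace (moment_matrix N \<nu> ** ?H)) (at_right 0)"
    by simp
  define F where "F r y = (u y - u 0) * (1 + m r / measure (weighted_measure \<Omega> w) (nball N y r))" for r y
  have F: "\<forall>\<^sub>F r in at_right 0. set_integrable (weighted_measure \<Omega> w) (B r) (F r)
      \<and> 1 / (2 * r\<^sup>2) * avg_integral (weighted_measure \<Omega> w) (B r) (F r) = D r / (r\<^sup>2 * m r)"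
    using sub P cont bdd
  proof eventually_elim
    case (elim r)
    show ?case
      using samv_average_eq(2,3)[OF elim(1,3) bspec[OF elim(4)] elim(2)]
      by (simp add: F_def[abs_def] avg_integral_def D_def)
  qed
  then have "((\<lambda>r. 1 / (2 * r\<^sup>2) * avg_integral (weighted_measure \<Omega> w) (B r) (F r))
      \<longlongrightarrow> 1 / 2 * trace (moment_matrix N \<nu> ** ?H)) (at_right 0)"
    by (intro Lim_transform_eventually[OF lim]) (auto elim: eventually_mono)
  with F show ?thesis
    unfolding has_samv_laplacian_def \<mu>_def Let_def F_def[abs_def]
    by (auto elim: eventually_mono)
qed

end
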